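(* Let $\mathbf H\in\mathbb R^{d\times d}$ be symmetric, $\mathbf g\in\mathbb R^d$, and let $g$ be the grade of $\mathbf g$ with respect to $\mathbf H$. Assume that all eigenvalues of $\mathbf H$ are $\mathbf g$-relevant, i.e. $\Psi(\mathbf H,\mathbf g)=\Theta(\mathbf H)$. 1. $\mathbf H\succ\mathbf 0$ if and only if the NPC condition $\langle\mathbf r_{t-1},\mathbf H\mathbf r_{t-1}\rangle\le0$ is never detected for all $1\le t\le g$. 2. $\mathbf H\succeq\mathbf 0$ if and only if the NPC condition is first detected at the last iteration $t=g$ and evaluates to zero, i.e. $\langle\mathbf r_{t-1},\mathbf H\mathbf r_{t-1}\rangle>0$ for $1\le t\le g-1$ and $\langle\mathbf r_{g-1},\mathbf H\mathbf r_{g-1}\rangle=0$.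
   Context: $\mathbf H\succ\mathbf 0$ and $\mathbf H\succeq\mathbf 0$ mean that $\mathbf H$ is positive definite and positive semidefinite, respectively. $\Theta(\mathbf H)$ is the set of eigenvalues of $\mathbf H$. An eigenvalue $\lambda\in\Theta(\mathbf H)$ is called $\mathbf g$-relevant if $\mathbf g$ is not orthogonal to the eigenspace $\mathrm{Null}(\mathbf H-\lambda\mathbf I)$, and $\Psi(\mathbf H,\mathbf g)$ is the set of all $\mathbf g$-relevant eigenvalues (so the assumption forces $\mathbf g\neq\mathbf 0$). $\mathcal K_t(\mathbf H,\mathbf g)=\mathrm{Span}\{\mathbf g,\mathbf H\mathbf g,\dots,\mathbf H^{t-1}\mathbf g\}$. The grade $g$ of $\mathbf g$ with respect to $\mathbf H$ is the positive integer with $\dim\mathcal K_t(\mathbf H,\mathbf g)=\min\{t,g\}$ for all $t\ge1$. MINRES (minimum residual method, exact arithmetic): $\mathbf s_0=\mathbf 0$, $\mathbf r_0=-\mathbf g$, and for $t\ge1$, $\mathbf s_t=\arg\min_{\mathbf s\in\mathcal K_t(\mathbf H,\mathbf g)}\|\mathbf H\mathbf s+\mathbf g\|^2$ and $\mathbf r_t=-\mathbf g-\mathbf H\mathbf s_t$ (the residual is unique even if $\mathbf s_t$ is not). The NPC (nonpositive curvature) condition at iteration $t$ is $\langle\mathbf r_{t-1},\mathbf H\mathbf r_{t-1}\rangle\le0$; it is said to be detected at iteration $t$ if this inequality holds.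
   Formalization: Part 2 is stated for H positive semidefinite but not positive definite, since for every positive definite H the literal equivalence fails (e.g. d=1, H=1, g=1: grade 1 and ⟨r_0,Hr_0⟩=1, not 0). *)

theory Defs
  imports "HOL-Analysis.Analysis"
begin

definition posdef :: "real ^ 'n ^ 'n \<Rightarrow> bool" where
  "posdef H \<longleftrightarrow> transpose H = H \<and> (\<forall>x. x \<noteq> 0 \<longrightarrow> x \<bullet> (H *v x) > 0)"

definition possemidef :: "real ^ 'n ^ 'n \<Rightarrow> bool" where
  "possemidef H \<longleftrightarrow> transpose H = H \<and> (\<forall>x. x \<bullet> (H *v x) \<ge> 0)"

definition eigenspace :: "real ^ 'n ^ 'n \<Rightarrow> real \<Rightarrow> (real ^ 'n) set" where
  "eigenspace H \<mu> = {v. (H - \<mu> *\<^sub>R mat 1) *v v = 0}"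

(* Only real eigenvalues are collected; for symmetric H these are all of them. *)
definition eigenvalues :: "real ^ 'n ^ 'n \<Rightarrow> real set" where
  "eigenvalues H = {\<mu>. \<exists>v. v \<noteq> 0 \<and> H *v v = \<mu> *\<^sub>R v}"

definition relevant_eigenvalues :: "real ^ 'n ^ 'n \<Rightarrow> real ^ 'n \<Rightarrow> real set" where
  "relevant_eigenvalues H g =
     {\<mu> \<in> eigenvalues H. \<not> (\<forall>v \<in> eigenspace H \<mu>. orthogonal g v)}"

(* The i-th generator is H^i g, written as the i-fold iterate of H *v _ applied to g. *)
definition krylov :: "real ^ 'n ^ 'n \<Rightarrow> real ^ 'n \<Rightarrow> nat \<Rightarrow> (real ^ 'n) set" where
  "krylov H g t = span ((\<lambda>i. ((*v) H ^^ i) g) ` {..<t})"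

(* Such an m exists and is unique whenever g is nonzero; for g = 0 the value is unspecified. *)
definition grade :: "real ^ 'n ^ 'n \<Rightarrow> real ^ 'n \<Rightarrow> nat" where
  "grade H g = (THE m. m > 0 \<and> (\<forall>t\<ge>1. dim (krylov H g t) = min t m))"

(* A predicate rather than a function, because the minimiser need not be unique
   when H is singular. *)
definition minres_iterates :: "real ^ 'n ^ 'n \<Rightarrow> real ^ 'n \<Rightarrow> (nat \<Rightarrow> real ^ 'n) \<Rightarrow> bool" where
  "minres_iterates H g s \<longleftrightarrow>
     s 0 = 0 \<and>
     (\<forall>t\<ge>1. is_arg_min (\<lambda>x. (norm (H *v x + g))\<^sup>2) (\<lambda>x. x \<in> krylov H g t) (s t))"

definition residual :: "real ^ 'n ^ 'n \<Rightarrow> real ^ 'n \<Rightarrow> real ^ 'n \<Rightarrow> real ^ 'n" where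
  "residual H g x = - g - H *v x"

definition npc_detected ::
    "real ^ 'n ^ 'n \<Rightarrow> real ^ 'n \<Rightarrow> (nat \<Rightarrow> real ^ 'n) \<Rightarrow> nat \<Rightarrow> bool" where
  "npc_detected H g s t \<longleftrightarrow>
     residual H g (s (t - 1)) \<bullet> (H *v residual H g (s (t - 1))) \<le> 0"

lemma minres_iterates_exist: "\<exists>s. minres_iterates H g s"
proof -
  have ex: "\<exists>x. is_arg_min (\<lambda>x. (norm (H *v x + g))\<^sup>2) (\<lambda>x. x \<in> krylov H g t) x" for t
  proof -
    let ?S = "(*v) H ` krylov H g t"
    have sub: "subspace ?S"
      by (intro linear_subspace_image) (auto simp: krylov_def)
    then have "closed ?S" "?S \<noteq> {}"
      using closed_subspace subspace_0 by blast+
    then obtain y where y: "y \<in> ?S" "\<And>z. z \<in> ?S \<Longrightarrow> dist (- g) y \<le> dist (- g) z"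
      using distance_attains_inf[of ?S "- g"] by blast
    then obtain x where x: "x \<in> krylov H g t" "y = H *v x" by blast
    have d: "dist (- g) z = norm (z + g)" for z
      by (metis add.commute diff_minus_eq_add dist_commute dist_norm)
    have "norm (H *v x + g) \<le> norm (H *v z + g)" if "z \<in> krylov H g t" for z
      using y(2)[of "H *v z"] that x by (simp add: d)
    then show ?thesis
      using x(1) by (auto simp: is_arg_min_linorder intro!: exI[of _ x] power_mono)
  qed
  then obtain s where
    "\<And>t. is_arg_min (\<lambda>x. (norm (H *v x + g))\<^sup>2) (\<lambda>x. x \<in> krylov H g t) (s t)"
    by metis
  then have "minres_iterates H g (s(0 := 0))"
    by (simp add: minres_iterates_def)
  then show ?thesis by blast
qed

end

theory Submission
  imports Defs
begin

text \<open>
  Write \<open>K t\<close> for the Krylov spaces, \<open>m\<close> for the grade and \<open>r t\<close> for the residuals. The residuals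
  build up the Krylov spaces one direction at a time: \<open>r t\<close> lies in \<open>K (Suc t)\<close> and,
  by minimality, is orthogonal to the image of \<open>K t\<close> under \<open>H\<close>. So whenever \<open>r t\<close> is not already
  in \<open>K t\<close>, it extends \<open>K t\<close> to \<open>K (Suc t)\<close> by a direction that is conjugate to \<open>K t\<close> with respect to \<open>H\<close>
  (\<open>quadratic_form_on_extension\<close>). Hence positive curvature of \<open>r 0, \<dots>, r (t - 1)\<close> makes the
  quadratic form of \<open>H\<close> positive definite on \<open>K t\<close> (\<open>positive_on_krylov\<close>), and one last residual of
  zero curvature leaves it semidefinite on \<open>K m\<close>.

  What happens on \<open>K m\<close> decides about \<open>H\<close> itself because all eigenvalues are relevant: \<open>K m\<close> and,
  by symmetry, its orthogonal complement are invariant under \<open>H\<close>, so the component in \<open>K m\<close> of an eigenvector is an eigenvector unless it is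
  zero, and it is not zero if the eigenvector is not orthogonal to \<open>g\<close>. In particular the least
  eigenvalue, which governs definiteness, has an eigenvector in \<open>K m\<close>
  (\<open>least_eigenvector_in_krylov\<close>).

  For the other directions, the residuals before the grade do not vanish (\<open>residual_nonzero\<close>), which
  settles the definite case, and \<open>H\<close> is injective on \<open>K t\<close> for \<open>t < m\<close> (\<open>injective_on_krylov\<close>).
  If \<open>H\<close> is semidefinite, a residual of zero curvature is a null vector, so this cannot happen
  before the last iteration. If \<open>H\<close> is moreover singular, it has a null vector in \<open>K m\<close>, which by injectivity is not in \<open>K (m - 1)\<close>; therefore both
  spaces have the same image under \<open>H\<close>, the last residual is orthogonal to the image of all of
  \<open>K m\<close>, and its curvature is zero.
\<close>

section \<open>Quadratic forms of symmetric matrices\<close>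

lemma linear_coefficient_zero_if_nonneg:
  fixes a b :: real
  assumes "\<And>e. 0 \<le> 2 * e * a + e\<^sup>2 * b"
  shows "a = 0"
proof (rule ccontr)
  assume a: "a \<noteq> 0"
  define c where "c = \<bar>b\<bar> + 1"
  have c: "c > 0" "b \<le> c" by (auto simp: c_def)
  have "0 \<le> 2 * (- a / c) * a + (- a / c)\<^sup>2 * b" by (rule assms)
  also have "\<dots> \<le> 2 * (- a / c) * a + (- a / c)\<^sup>2 * c"
    using c by (intro add_left_mono mult_left_mono) auto
  also have "\<dots> = - (a\<^sup>2 / c)"
    using c by (simp add: power2_eq_square field_simps)
  also have "\<dots> < 0" using a c by simp
  finally show False by simp
qed

lemma symmetric_dot_commute:
  fixes H :: "real ^ 'n ^ 'n"
  assumes "transpose H = H"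
  shows "(H *v x) \<bullet> y = x \<bullet> (H *v y)"
  by (metis assms dot_lmul_matrix transpose_matrix_vector)

lemma quadratic_form_add:
  fixes H :: "real ^ 'n ^ 'n"
  assumes "transpose H = H"
  shows "(x + c *\<^sub>R y) \<bullet> (H *v (x + c *\<^sub>R y)) =
    x \<bullet> (H *v x) + 2 * c * (y \<bullet> (H *v x)) + c\<^sup>2 * (y \<bullet> (H *v y))"
  using symmetric_dot_commute[OF assms, of x y]
  by (simp add: matrix_vector_right_distrib matrix_vector_mult_scaleR inner_add inner_commute
      power2_eq_square algebra_simps)

text \<open>The quadratic form has a minimum at such a vector, so its gradient vanishes there.\<close>

lemma semidefinite_null_vector:
  fixes H :: "real ^ 'n ^ 'n"
  assumes sym: "transpose H = H" and nonneg: "\<And>x. x \<bullet> (H *v x) \<ge> 0" and v: "v \<bullet> (H *v v) = 0"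
  shows "H *v v = 0"
proof -
  let ?w = "H *v v"
  have "0 \<le> 2 * e * (?w \<bullet> ?w) + e\<^sup>2 * (?w \<bullet> (H *v ?w))" for e
    using nonneg[of "v + e *\<^sub>R ?w"] by (simp add: quadratic_form_add[OF sym] v)
  then have "?w \<bullet> ?w = 0" by (rule linear_coefficient_zero_if_nonneg)
  then show ?thesis by simp
qed

text \<open>
  The eigenvector is a minimiser of the quadratic form on the unit sphere: subtracting the minimum
  \<open>\<mu>\<close> from \<open>H\<close> leaves a semidefinite matrix, for which the minimiser is a null vector.
\<close>

lemma symmetric_least_eigenvalue:
  fixes H :: "real ^ 'n ^ 'n"
  assumes sym: "transpose H = H"
  obtains \<mu> v where "v \<noteq> 0" "H *v v = \<mu> *\<^sub>R v" "\<And>x. \<mu> * (x \<bullet> x) \<le> x \<bullet> (H *v x)"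
proof -
  let ?q = "\<lambda>x. x \<bullet> (H *v x)"
  have "axis undefined 1 \<in> sphere (0 :: real ^ 'n) 1"
    by (simp add: norm_axis_1)
  moreover have "continuous_on (sphere 0 1) ?q"
    by (intro continuous_intros)
  ultimately obtain v where v: "v \<in> sphere 0 1" "\<And>y. y \<in> sphere 0 1 \<Longrightarrow> ?q v \<le> ?q y"
    using continuous_attains_inf[OF compact_sphere, of 0 1 ?q] by blast
  define \<mu> where "\<mu> = ?q v"
  have vv: "v \<bullet> v = 1" using v(1) by (simp add: norm_eq_1)
  have least: "\<mu> * (x \<bullet> x) \<le> ?q x" for x
  proof (cases "x = 0")
    case False
    let ?y = "x /\<^sub>R norm x"
    have "?q x = (norm x)\<^sup>2 * ?q ?y"
      using False by (simp add: matrix_vector_mult_scaleR power2_eq_square field_simps)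
    moreover have "\<mu> \<le> ?q ?y"
      unfolding \<mu>_def using False by (intro v(2)) simp
    ultimately show ?thesis
      by (metis mult.commute mult_left_mono power2_norm_eq_inner zero_le_power2)
  qed simp
  let ?A = "H - \<mu> *\<^sub>R mat 1"
  have A: "?A *v x = H *v x - \<mu> *\<^sub>R x" for x
    by (simp add: matrix_vector_mult_diff_rdistrib scaleR_matrix_vector_assoc[symmetric])
  have "transpose ?A = ?A"
    using sym by (simp add: transpose_def vec_eq_iff mat_def)
  moreover have "x \<bullet> (?A *v x) \<ge> 0" for x
    using least[of x] by (simp add: A inner_diff_right)
  moreover have "v \<bullet> (?A *v v) = 0"
    by (simp add: A inner_diff_right vv flip: \<mu>_def)
  ultimately have "?A *v v = 0" by (rule semidefinite_null_vector)
  then have "H *v v = \<mu> *\<^sub>R v" by (simp add: A)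
  moreover have "v \<noteq> 0" using vv by auto
  ultimately show ?thesis using least that by blast
qed

section \<open>Krylov spaces\<close>

lemma subspace_krylov: "subspace (krylov H g t)"
  by (simp add: krylov_def)

lemma krylov_0 [simp]: "krylov H g 0 = {0}"
  by (simp add: krylov_def)

lemma krylov_mono: "s \<le> t \<Longrightarrow> krylov H g s \<subseteq> krylov H g t"
  unfolding krylov_def by (intro span_mono image_mono) auto

lemma krylov_Suc: "krylov H g (Suc t) = span (insert (((*v) H ^^ t) g) (krylov H g t))"
  unfolding krylov_def lessThan_Suc image_insert span_insert by (simp add: span_span)

lemma start_in_krylov: "t > 0 \<Longrightarrow> g \<in> krylov H g t"
  unfolding krylov_def by (rule span_base) (auto intro!: image_eqI[where x = 0])

lemma image_krylov_subset: "(*v) H ` krylov H g t \<subseteq> krylov H g (Suc t)"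
proof -
  have "(*v) H ` krylov H g t = span ((*v) H ` (\<lambda>i. ((*v) H ^^ i) g) ` {..<t})"
    unfolding krylov_def by (rule linear_span_image[symmetric]) simp
  also have "\<dots> \<subseteq> krylov H g (Suc t)"
    unfolding krylov_def
    by (intro span_mono) (auto intro!: image_eqI[where x = "Suc _"])
  finally show ?thesis .
qed

text \<open>
  The generators enter the subspace one after the other: each is the image of the previous one,
  which lies in the smaller Krylov space. So invariance on that space suffices.
\<close>

lemma krylov_minimal:
  assumes S: "subspace S" and g: "g \<in> S" and inv: "(*v) H ` (krylov H g t \<inter> S) \<subseteq> S"
  shows "krylov H g (Suc t) \<subseteq> S"
proof -
  have "((*v) H ^^ i) g \<in> S" if "i \<le> t" for i
    using that
  proof (induction i)
    case (Suc i)
    then have "((*v) H ^^ i) g \<in> krylov H g t"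
      unfolding krylov_def by (intro span_base) auto
    with Suc inv show ?case by auto
  qed (use g in simp)
  then show ?thesis
    unfolding krylov_def by (intro span_minimal S) auto
qed

text \<open>Consecutive Krylov spaces differ by one dimension at most, so any new vector completes the
  smaller one.\<close>

lemma krylov_Suc_decomp:
  assumes x: "x \<in> krylov H g (Suc t)" "x \<notin> krylov H g t" and y: "y \<in> krylov H g (Suc t)"
  obtains z c where "z \<in> krylov H g t" "y = z + c *\<^sub>R x"
proof -
  let ?K = "krylov H g t" and ?h = "((*v) H ^^ t) g"
  have K: "subspace ?K" by (rule subspace_krylov)
  then have span_K: "span ?K = ?K" by simp
  have h: "?h \<in> span (insert x ?K)"
    using x in_span_insert[of x ?h ?K] by (simp add: krylov_Suc span_K)
  have "span (insert ?h ?K) \<subseteq> span (insert x ?K)"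
    using h by (intro span_minimal) (auto intro: span_base)
  then have "y \<in> span (insert x ?K)"
    using y unfolding krylov_Suc by blast
  then obtain c where "y - c *\<^sub>R x \<in> ?K"
    by (auto simp: span_breakdown_eq span_K)
  then show ?thesis using that[of "y - c *\<^sub>R x" c] by simp
qed

text \<open>
  The defining property of the grade can be met, and only in one way: the dimension grows by one until
  some \<open>H\<^sup>i g\<close> depends on the earlier ones, and is constant from then on. For \<open>g = 0\<close> this would
  happen at \<open>i = 0\<close>, and the grade could not be positive.
\<close>

lemma grade_is_dimension_bound:
  fixes H :: "real ^ 'n ^ 'n"
  assumes g: "g \<noteq> 0"
  shows "grade H g > 0 \<and> (\<forall>t\<ge>1. dim (krylov H g t) = min t (grade H g))"
proof -
  let ?K = "krylov H g" and ?h = "\<lambda>i. ((*v) H ^^ i) g"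
  let ?P = "\<lambda>m. m > 0 \<and> (\<forall>t\<ge>1. dim (?K t) = min t m)"
  have dim_Suc: "dim (?K (Suc t)) = (if ?h t \<in> ?K t then dim (?K t) else Suc (dim (?K t)))" for t
    using dim_insert[of "?h t" "?K t"] span_eq_iff[THEN iffD2, OF subspace_krylov[of H g t]]
    by (simp add: krylov_Suc)
  have grow: "dim (?K t) = t" if "\<forall>i<t. ?h i \<notin> ?K i" for t
    using that by (induction t) (auto simp: dim_Suc)
  have "\<exists>i. ?h i \<in> ?K i"
  proof (rule ccontr)
    assume "\<nexists>i. ?h i \<in> ?K i"
    then have "dim (?K (Suc CARD('n))) = Suc CARD('n)" by (intro grow) auto
    moreover have "dim (?K (Suc CARD('n))) \<le> CARD('n)"
      using dim_subset_UNIV[of "?K (Suc CARD('n))"] by simp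
    ultimately show False by simp
  qed
  then obtain m where m: "?h m \<in> ?K m" "\<forall>i<m. ?h i \<notin> ?K i"
    using exists_least_iff[of "\<lambda>i. ?h i \<in> ?K i"] by blast
  have "m > 0" using m g by (cases m) auto
  (* Once a generator is redundant, the space is invariant and stays the same. *)
  have inv: "(*v) H ` ?K m \<subseteq> ?K m"
    using image_krylov_subset[of H g m] m(1)
      span_eq_iff[THEN iffD2, OF subspace_krylov[of H g m]]
    by (simp add: krylov_Suc insert_absorb)
  have stop: "?K t = ?K m" if "t \<ge> m" for t
  proof
    have "?K (Suc t) \<subseteq> ?K m"
      using inv start_in_krylov[OF \<open>m > 0\<close>] by (intro krylov_minimal subspace_krylov) auto
    then show "?K t \<subseteq> ?K m" using krylov_mono[of t "Suc t" H g] by auto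
  qed (use that in \<open>rule krylov_mono\<close>)
  have "dim (?K t) = min t m" for t
    using grow[of t] grow[of m] m(2) stop[of t] by (cases "t \<le> m") simp_all
  with \<open>m > 0\<close> have P: "?P m" by simp
  have "k = m" if k: "?P k" for k
  proof -
    have "max k m \<ge> 1" using \<open>m > 0\<close> by simp
    with k P have "min (max k m) k = min (max k m) m" by metis
    then show ?thesis by (simp add: min_def max_def split: if_splits)
  qed
  with P have "?P (THE m. ?P m)" by (rule theI)
  then show ?thesis unfolding grade_def .
qed

lemma dim_krylov:
  assumes "g \<noteq> 0" "t \<le> grade H g"
  shows "dim (krylov H g t) = t"
  using grade_is_dimension_bound[of g H] assms by (cases t) auto

lemma krylov_grade_invariant:
  assumes g: "g \<noteq> 0"
  shows "(*v) H ` krylov H g (grade H g) \<subseteq> krylov H g (grade H g)"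
proof -
  let ?m = "grade H g"
  have "dim (krylov H g (Suc ?m)) = dim (krylov H g ?m)"
    using grade_is_dimension_bound[OF g, of H] by simp
  then have "krylov H g ?m = krylov H g (Suc ?m)"
    by (intro subspace_dim_equal subspace_krylov krylov_mono) auto
  then show ?thesis using image_krylov_subset[of H g ?m] by simp
qed

text \<open>
  A null vector of \<open>H\<close> that is new in \<open>K (Suc k)\<close> contributes nothing to the image, so
  \<open>K (Suc k)\<close> has the same image under \<open>H\<close> as \<open>K k\<close>.
\<close>

lemma image_krylov_Suc_null_vector:
  assumes "x \<in> krylov H g (Suc k)" "x \<notin> krylov H g k" "H *v x = 0"
  shows "(*v) H ` krylov H g (Suc k) \<subseteq> (*v) H ` krylov H g k"
proof clarify
  fix y assume "y \<in> krylov H g (Suc k)"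
  with assms(1,2) obtain z c where "z \<in> krylov H g k" "y = z + c *\<^sub>R x"
    by (rule krylov_Suc_decomp)
  then show "H *v y \<in> (*v) H ` krylov H g k"
    by (simp add: matrix_vector_right_distrib matrix_vector_mult_scaleR assms(3))
qed

text \<open>
  The first Krylov space that contains a nonzero null vector of \<open>H\<close> is invariant under \<open>H\<close>, so the
  Krylov spaces stop growing there; they grow until the grade is reached.
\<close>

lemma injective_on_krylov:
  fixes H :: "real ^ 'n ^ 'n"
  assumes g: "g \<noteq> 0" and t: "t < grade H g" and x: "x \<in> krylov H g t" "H *v x = 0"
  shows "x = 0"
proof (rule ccontr)
  assume "x \<noteq> 0"
  obtain k where k: "x \<in> krylov H g k" "\<forall>i<k. x \<notin> krylov H g i"
    using x(1) exists_least_iff[of "\<lambda>k. x \<in> krylov H g k"] by blast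
  have "k \<le> t" using k(2) x(1) by (metis not_le)
  obtain j where j: "k = Suc j" using k(1) \<open>x \<noteq> 0\<close> by (cases k) auto
  have "(*v) H ` krylov H g k \<subseteq> (*v) H ` krylov H g j"
    unfolding j using k x(2) by (intro image_krylov_Suc_null_vector) (auto simp: j)
  also have "\<dots> \<subseteq> krylov H g k"
    unfolding j by (rule image_krylov_subset)
  finally have "krylov H g (Suc k) \<subseteq> krylov H g k"
    using start_in_krylov[of k g H] by (intro krylov_minimal subspace_krylov) (auto simp: j)
  then have "dim (krylov H g (Suc k)) \<le> dim (krylov H g k)" by (rule dim_subset)
  then show False using dim_krylov[OF g] t \<open>k \<le> t\<close> by simp
qed

section \<open>Eigenvectors in the last Krylov space\<close>

text \<open>
  The eigenvector is the orthogonal projection to \<open>K\<close> of an eigenvector that is not orthogonal to \<open>g\<close>.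
  The projection has the same inner product with \<open>g \<in> K\<close>, so it is not zero.
\<close>

lemma relevant_eigenvector_in_invariant_subspace:
  fixes H :: "real ^ 'n ^ 'n"
  assumes sym: "transpose H = H" and K: "subspace K" and inv: "(*v) H ` K \<subseteq> K" and g: "g \<in> K"
    and \<mu>: "\<mu> \<in> relevant_eigenvalues H g"
  obtains v where "v \<in> K" "v \<noteq> 0" "H *v v = \<mu> *\<^sub>R v"
proof -
  obtain w where w: "H *v w = \<mu> *\<^sub>R w" "g \<bullet> w \<noteq> 0"
    using \<mu> by (auto simp: relevant_eigenvalues_def eigenspace_def orthogonal_def
        matrix_vector_mult_diff_rdistrib scaleR_matrix_vector_assoc[symmetric])
  obtain v u where vu: "v \<in> span K" "\<And>y. y \<in> span K \<Longrightarrow> orthogonal u y" "w = v + u"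
    by (rule orthogonal_subspace_decomp_exists[of K w]) blast
  have span_K: "span K = K" using K by simp
  have v: "v \<in> K" using vu(1) by (simp add: span_K)
  have u: "u \<bullet> y = 0" if "y \<in> K" for y
    using vu(2) that by (simp add: span_K orthogonal_def)
  (* H maps both the subspace and its orthogonal complement to themselves, so the eigenvalue
     equation of w splits into one for each component. *)
  let ?d = "H *v v - \<mu> *\<^sub>R v"
  have d: "?d \<in> K"
    using v inv K by (intro subspace_diff subspace_scale) auto
  have d_eq: "?d = \<mu> *\<^sub>R u - H *v u"
    using w(1) by (simp add: vu(3) matrix_vector_right_distrib algebra_simps)
  have "(\<mu> *\<^sub>R u - H *v u) \<bullet> y = 0" if "y \<in> K" for y
  proof -
    have "H *v y \<in> K" using that inv by auto
    then show ?thesis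
      using u that by (simp add: inner_diff_left symmetric_dot_commute[OF sym])
  qed
  from this[OF d] have "?d \<bullet> ?d = 0" unfolding d_eq[symmetric] .
  then have "H *v v = \<mu> *\<^sub>R v" by simp
  moreover have "v \<noteq> 0"
    using w(2) u[OF g] by (auto simp: vu(3) inner_commute)
  ultimately show ?thesis using that v by blast
qed

lemma least_eigenvector_in_krylov:
  fixes H :: "real ^ 'n ^ 'n"
  assumes sym: "transpose H = H" and rel: "relevant_eigenvalues H g = eigenvalues H"
    and g: "g \<noteq> 0"
  obtains \<mu> v where "v \<in> krylov H g (grade H g)" "v \<noteq> 0" "H *v v = \<mu> *\<^sub>R v"
    "\<And>x. \<mu> * (x \<bullet> x) \<le> x \<bullet> (H *v x)"
proof -
  obtain \<mu> w where \<mu>: "w \<noteq> 0" "H *v w = \<mu> *\<^sub>R w" "\<And>x. \<mu> * (x \<bullet> x) \<le> x \<bullet> (H *v x)"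
    by (rule symmetric_least_eigenvalue[OF sym]) blast
  then have "\<mu> \<in> relevant_eigenvalues H g"
    unfolding rel eigenvalues_def by blast
  moreover have "g \<in> krylov H g (grade H g)"
    using grade_is_dimension_bound[OF g, of H] by (intro start_in_krylov) simp
  ultimately obtain v where "v \<in> krylov H g (grade H g)" "v \<noteq> 0" "H *v v = \<mu> *\<^sub>R v"
    using relevant_eigenvector_in_invariant_subspace[OF sym subspace_krylov
        krylov_grade_invariant[OF g]] by blast
  then show ?thesis using \<mu>(3) that by blast
qed

lemma posdef_if_positive_on_krylov:
  fixes H :: "real ^ 'n ^ 'n"
  assumes sym: "transpose H = H" and rel: "relevant_eigenvalues H g = eigenvalues H"
    and g: "g \<noteq> 0"
    and pos: "\<And>x. x \<in> krylov H g (grade H g) \<Longrightarrow> x \<noteq> 0 \<Longrightarrow> x \<bullet> (H *v x) > 0"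
  shows "posdef H"
proof -
  obtain \<mu> v where v: "v \<in> krylov H g (grade H g)" "v \<noteq> 0" "H *v v = \<mu> *\<^sub>R v"
    and least: "\<And>x. \<mu> * (x \<bullet> x) \<le> x \<bullet> (H *v x)"
    by (rule least_eigenvector_in_krylov[OF sym rel g]) blast
  have "\<mu> * (v \<bullet> v) > 0" "v \<bullet> v > 0"
    using pos[OF v(1,2)] v(2,3) by simp_all
  then have "\<mu> > 0" by (rule zero_less_mult_pos2)
  then have "0 < x \<bullet> (H *v x)" if "x \<noteq> 0" for x
    using least[of x] that by (intro less_le_trans[OF _ least]) simp
  then show ?thesis by (simp add: posdef_def sym)
qed

lemma possemidef_if_nonneg_on_krylov:
  fixes H :: "real ^ 'n ^ 'n"
  assumes sym: "transpose H = H" and rel: "relevant_eigenvalues H g = eigenvalues H"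
    and g: "g \<noteq> 0"
    and nonneg: "\<And>x. x \<in> krylov H g (grade H g) \<Longrightarrow> x \<bullet> (H *v x) \<ge> 0"
  shows "possemidef H"
proof -
  obtain \<mu> v where v: "v \<in> krylov H g (grade H g)" "v \<noteq> 0" "H *v v = \<mu> *\<^sub>R v"
    and least: "\<And>x. \<mu> * (x \<bullet> x) \<le> x \<bullet> (H *v x)"
    by (rule least_eigenvector_in_krylov[OF sym rel g]) blast
  have "\<mu> * (v \<bullet> v) \<ge> 0" "v \<bullet> v > 0"
    using nonneg[OF v(1)] v(2,3) by simp_all
  then have "\<mu> \<ge> 0" by (metis linorder_not_le mult_neg_pos)
  then have "0 \<le> x \<bullet> (H *v x)" for x
    by (intro order_trans[OF _ least]) simp
  then show ?thesis by (simp add: possemidef_def sym)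
qed

section \<open>Residuals\<close>

lemma minres_iterate_in_krylov:
  assumes "minres_iterates H g s"
  shows "s t \<in> krylov H g t"
  using assms by (cases t) (auto simp: minres_iterates_def is_arg_min_def)

lemma residual_in_krylov:
  assumes "minres_iterates H g s"
  shows "residual H g (s t) \<in> krylov H g (Suc t)"
  using minres_iterate_in_krylov[OF assms, of t] image_krylov_subset[of H g t]
    start_in_krylov[of "Suc t" g H] subspace_krylov[of H g "Suc t"]
  unfolding residual_def by (intro subspace_diff subspace_neg) auto

text \<open>
  This is the stationarity of the squared residual norm under moving the iterate in the direction
  \<open>y\<close>.
\<close>

lemma residual_orthogonal:
  fixes H :: "real ^ 'n ^ 'n"
  assumes s: "minres_iterates H g s" and y: "y \<in> krylov H g t"
  shows "residual H g (s t) \<bullet> (H *v y) = 0"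
proof (cases t)
  case 0
  then show ?thesis using y by simp
next
  case (Suc k)
  let ?p = "H *v s t + g" and ?w = "H *v y"
  have "(norm ?p)\<^sup>2 \<le> (norm (H *v (s t + e *\<^sub>R y) + g))\<^sup>2" for e
    using s y minres_iterate_in_krylov[OF s, of t] subspace_krylov[of H g t] Suc
    by (auto simp: minres_iterates_def is_arg_min_linorder intro: subspace_add subspace_scale)
  moreover have "H *v (s t + e *\<^sub>R y) + g = ?p + e *\<^sub>R ?w" for e
    by (simp add: matrix_vector_right_distrib matrix_vector_mult_scaleR)
  ultimately have "(norm ?p)\<^sup>2 \<le> (norm (?p + e *\<^sub>R ?w))\<^sup>2" for e
    by metis
  then have "0 \<le> 2 * e * (?p \<bullet> ?w) + e\<^sup>2 * (?w \<bullet> ?w)" for e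
    using order_trans[of "(norm ?p)\<^sup>2" "(norm (?p + e *\<^sub>R ?w))\<^sup>2"]
    unfolding power2_norm_eq_inner
    by (simp add: inner_add inner_commute power2_eq_square algebra_simps)
  then have "?p \<bullet> ?w = 0" by (rule linear_coefficient_zero_if_nonneg)
  moreover have "residual H g (s t) = - ?p" by (simp add: residual_def)
  ultimately show ?thesis by (metis inner_minus_left minus_zero)
qed

text \<open>
  If a residual vanishes, \<open>g\<close> lies in the image of \<open>K t\<close>, and so does all of
  \<open>K (Suc t)\<close>; this is too big for the image unless \<open>t\<close> has reached the grade.
\<close>

lemma residual_nonzero:
  fixes H :: "real ^ 'n ^ 'n"
  assumes s: "minres_iterates H g s" and g: "g \<noteq> 0" and t: "t < grade H g"
  shows "residual H g (s t) \<noteq> 0"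
proof
  assume "residual H g (s t) = 0"
  then have "- g = H *v s t" by (simp add: residual_def)
  then have "g = H *v (- s t)" by (metis minus_minus vec.neg)
  then have "g \<in> (*v) H ` krylov H g t"
    using minres_iterate_in_krylov[OF s, of t] subspace_krylov[of H g t]
    by (blast intro: subspace_neg)
  then have "krylov H g (Suc t) \<subseteq> (*v) H ` krylov H g t"
    by (intro krylov_minimal linear_subspace_image subspace_krylov) auto
  then have "dim (krylov H g (Suc t)) \<le> dim ((*v) H ` krylov H g t)"
    by (rule dim_subset)
  also have "\<dots> \<le> dim (krylov H g t)"
    by (rule dim_image_le) simp
  finally show False using dim_krylov[OF g] t by simp
qed

text \<open>
  The mixed term of the quadratic form is the inner product of the residual with \<open>H z\<close>, which is
  zero because \<open>z\<close> lies in the space over which the iterate minimises.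
\<close>

lemma quadratic_form_on_extension:
  fixes H :: "real ^ 'n ^ 'n"
  assumes sym: "transpose H = H" and s: "minres_iterates H g s"
    and new: "residual H g (s t) \<notin> krylov H g t" and x: "x \<in> krylov H g (Suc t)"
  obtains z c where "z \<in> krylov H g t" "x = z + c *\<^sub>R residual H g (s t)"
    "x \<bullet> (H *v x) =
      z \<bullet> (H *v z) + c\<^sup>2 * (residual H g (s t) \<bullet> (H *v residual H g (s t)))"
proof -
  obtain z c where z: "z \<in> krylov H g t" "x = z + c *\<^sub>R residual H g (s t)"
    by (rule krylov_Suc_decomp[OF residual_in_krylov[OF s] new x])
  show ?thesis
    by (rule that[OF z])
      (simp add: z(2) quadratic_form_add[OF sym] residual_orthogonal[OF s z(1)])
qed

lemma positive_on_krylov: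
  fixes H :: "real ^ 'n ^ 'n"
  assumes sym: "transpose H = H" and s: "minres_iterates H g s"
    and pos: "\<And>i. i < t \<Longrightarrow> residual H g (s i) \<bullet> (H *v residual H g (s i)) > 0"
    and x: "x \<in> krylov H g t" "x \<noteq> 0"
  shows "x \<bullet> (H *v x) > 0"
  using pos x
proof (induction t arbitrary: x)
  case (Suc t)
  let ?r = "residual H g (s t)"
  have r: "?r \<bullet> (H *v ?r) > 0" using Suc.prems by simp
  (* A residual in its own Krylov space would be conjugate to itself. *)
  then have new: "?r \<notin> krylov H g t"
    using residual_orthogonal[OF s] by fastforce
  obtain z c where z: "z \<in> krylov H g t" "x = z + c *\<^sub>R ?r"
    "x \<bullet> (H *v x) = z \<bullet> (H *v z) + c\<^sup>2 * (?r \<bullet> (H *v ?r))"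
    by (rule quadratic_form_on_extension[OF sym s new Suc.prems(2)])
  show ?case
  proof (cases "z = 0")
    case True
    then have "c \<noteq> 0" using z(2) Suc.prems(3) by auto
    with True z(3) r show ?thesis by simp
  next
    case False
    then have "z \<bullet> (H *v z) > 0" using Suc.IH[OF _ z(1)] Suc.prems(1) by simp
    with z(3) r show ?thesis by (simp add: add_pos_nonneg)
  qed
qed simp

text \<open>
  Zero curvature would make the residual a nonzero null vector of \<open>H\<close> in \<open>K (Suc t)\<close>, too early for
  one to exist.
\<close>

lemma residual_curvature_positive_if_semidefinite:
  fixes H :: "real ^ 'n ^ 'n"
  assumes psd: "possemidef H" and s: "minres_iterates H g s" and g: "g \<noteq> 0"
    and t: "Suc t < grade H g"
  shows "residual H g (s t) \<bullet> (H *v residual H g (s t)) > 0"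
proof -
  let ?r = "residual H g (s t)"
  have "H *v ?r \<noteq> 0"
    using injective_on_krylov[OF g t residual_in_krylov[OF s]] residual_nonzero[OF s g] t
    by auto
  then have "?r \<bullet> (H *v ?r) \<noteq> 0"
    using psd semidefinite_null_vector[of H ?r] by (auto simp: possemidef_def)
  then show ?thesis using psd by (simp add: possemidef_def order_less_le)
qed

text \<open>
  The last residual is orthogonal to the image of \<open>K k\<close> under \<open>H\<close>, and the null vector makes this
  the image of the whole space \<open>K (Suc k)\<close>, which contains the residual itself.
\<close>

lemma last_residual_curvature_zero_if_singular:
  fixes H :: "real ^ 'n ^ 'n"
  assumes s: "minres_iterates H g s" and g: "g \<noteq> 0" and m: "grade H g = Suc k"
    and v: "v \<in> krylov H g (grade H g)" "v \<noteq> 0" "H *v v = 0"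
  shows "residual H g (s k) \<bullet> (H *v residual H g (s k)) = 0"
proof -
  have "v \<notin> krylov H g k"
    using injective_on_krylov[OF g _ _ v(3), of k] v(2) m by auto
  then have "(*v) H ` krylov H g (Suc k) \<subseteq> (*v) H ` krylov H g k"
    using v m by (intro image_krylov_Suc_null_vector) auto
  then obtain y where "y \<in> krylov H g k" "H *v residual H g (s k) = H *v y"
    using residual_in_krylov[OF s, of k] by blast
  then show ?thesis using residual_orthogonal[OF s] by simp
qed

section \<open>Definiteness and detection of nonpositive curvature\<close>

theorem theorem2:
  fixes H :: "real ^ 'n ^ 'n" and g :: "real ^ 'n" and s :: "nat \<Rightarrow> real ^ 'n"
  assumes "transpose H = H"
    and "relevant_eigenvalues H g = eigenvalues H"
    and "minres_iterates H g s"
  shows "(posdef H \<longleftrightarrow>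
            (\<forall>t. 1 \<le> t \<and> t \<le> grade H g \<longrightarrow> \<not> npc_detected H g s t)) \<and>
         (possemidef H \<and> \<not> posdef H \<longleftrightarrow>
            (\<forall>t. 1 \<le> t \<and> t \<le> grade H g - 1 \<longrightarrow>
               residual H g (s (t - 1)) \<bullet> (H *v residual H g (s (t - 1))) > 0) \<and>
            residual H g (s (grade H g - 1)) \<bullet>
              (H *v residual H g (s (grade H g - 1))) = 0)"
proof -
  note sym = assms(1) and rel = assms(2) and s = assms(3)
  let ?r = "\<lambda>t. residual H g (s t)"
  let ?q = "\<lambda>x. x \<bullet> (H *v x)"
  (* H has an eigenvalue, and an eigenvalue can be relevant only for a nonzero vector. *)
  have g: "g \<noteq> 0"
  proof
    assume "g = 0"
    then have "eigenvalues H = {}"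
      using rel by (auto simp: relevant_eigenvalues_def orthogonal_def)
    moreover obtain \<mu> v where "v \<noteq> 0" "H *v v = \<mu> *\<^sub>R v"
      by (rule symmetric_least_eigenvalue[OF sym])
    ultimately show False by (auto simp: eigenvalues_def)
  qed
  obtain k where m: "grade H g = Suc k"
    using grade_is_dimension_bound[OF g, of H] gr0_implies_Suc by blast
  (* The condition at iteration t concerns the residual with index t - 1. *)
  have shift: "(\<forall>t. 1 \<le> t \<and> t \<le> n \<longrightarrow> P (t - 1)) \<longleftrightarrow> (\<forall>t<n. P t)" for n :: nat and P
  proof
    assume P: "\<forall>t. 1 \<le> t \<and> t \<le> n \<longrightarrow> P (t - 1)"
    show "\<forall>t<n. P t"
      using P[rule_format, of "Suc _"] by simp
  qed auto

  have "posdef H \<longleftrightarrow> (\<forall>t<Suc k. ?q (?r t) > 0)"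
  proof
    assume "posdef H"
    then show "\<forall>t<Suc k. ?q (?r t) > 0"
      using residual_nonzero[OF s g] m by (auto simp: posdef_def)
  next
    assume "\<forall>t<Suc k. ?q (?r t) > 0"
    then show "posdef H"
      using positive_on_krylov[OF sym s] m
      by (intro posdef_if_positive_on_krylov[OF sym rel g]) auto
  qed
  moreover have "possemidef H \<and> \<not> posdef H \<longleftrightarrow> (\<forall>t<k. ?q (?r t) > 0) \<and> ?q (?r k) = 0"
  proof
    assume psd: "possemidef H \<and> \<not> posdef H"
    obtain \<mu> v where v: "v \<in> krylov H g (grade H g)" "v \<noteq> 0" "H *v v = \<mu> *\<^sub>R v"
      and least: "\<And>x. \<mu> * (x \<bullet> x) \<le> ?q x"
      by (rule least_eigenvector_in_krylov[OF sym rel g]) blast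
    (* The least eigenvalue is zero, so its eigenvector in the last Krylov space is a null vector. *)
    have "\<mu> \<le> 0"
    proof (rule ccontr)
      assume "\<not> \<mu> \<le> 0"
      then have "0 < ?q x" if "x \<noteq> 0" for x
        using that by (intro less_le_trans[OF _ least]) simp
      with psd sym show False by (auto simp: posdef_def)
    qed
    moreover have "\<mu> * (v \<bullet> v) \<ge> 0" "v \<bullet> v > 0"
      using psd v(2,3) unfolding possemidef_def by (metis inner_scaleR_right, simp)
    then have "\<mu> \<ge> 0" by (metis linorder_not_le mult_neg_pos)
    ultimately have "H *v v = 0" using v(3) by simp
    then show "(\<forall>t<k. ?q (?r t) > 0) \<and> ?q (?r k) = 0"
      using residual_curvature_positive_if_semidefinite[OF _ s g]
        last_residual_curvature_zero_if_singular[OF s g m v(1,2)] psd m by auto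
  next
    assume r: "(\<forall>t<k. ?q (?r t) > 0) \<and> ?q (?r k) = 0"
    have pos: "?q x > 0" if "x \<in> krylov H g k" "x \<noteq> 0" for x
      using positive_on_krylov[OF sym s _ that] r by blast
    have nz: "?r k \<noteq> 0" using residual_nonzero[OF s g] m by simp
    then have new: "?r k \<notin> krylov H g k" using pos r by fastforce
    have "?q x \<ge> 0" if "x \<in> krylov H g (grade H g)" for x
    proof -
      have "x \<in> krylov H g (Suc k)" using that m by simp
      then obtain z c where z: "z \<in> krylov H g k" "?q x = ?q z + c\<^sup>2 * ?q (?r k)"
        using quadratic_form_on_extension[OF sym s new] by metis
      then show ?thesis using pos[of z] r by (cases "z = 0") auto
    qed
    then have "possemidef H" by (rule possemidef_if_nonneg_on_krylov[OF sym rel g])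
    moreover have "\<not> posdef H" using nz r by (auto simp: posdef_def)
    ultimately show "possemidef H \<and> \<not> posdef H" by simp
  qed
  ultimately show ?thesis
    using shift[of "Suc k" "\<lambda>t. ?q (?r t) > 0"] shift[of k "\<lambda>t. ?q (?r t) > 0"]
    by (simp add: m npc_detected_def not_le)
qed

end
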